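(* Let $(M,g)$ be a four-dimensional oriented smooth Lorentzian manifold with Levi-Civita connection $\nabla$. Let (a) $K^\mu$ be a smooth vector field with values in $\mathrm{Herm}(2)$ satisfying $K^\mu\tilde K^\nu+K^\nu\tilde K^\mu=2g^{\mu\nu}e$ for all $\mu,\nu$ and $\nabla_\mu\pi_+(K^\mu)=0$; (b) $A_\mu$ and $C_\mu$ be smooth covector fields with values in $\mathfrak{u}(2)$ and $\mathfrak{su}(2)$ respectively; (c) $\Psi:M\to\mathrm{Mat}(2,\mathbb{C})$ be a smooth function. Suppose $$iK^\mu(\nabla_\mu\Psi-C_\mu\Psi+\Psi A_\mu)=0.$$ Then $$\big(\nabla_\mu(\Psi^\dagger iK^\mu\Psi)-[A_\mu,\Psi^\dagger iK^\mu\Psi]\big)-\Psi^\dagger\big(\nabla_\mu\pi_-(iK^\mu)-[C_\mu,\pi_-(iK^\mu)]\big)\Psi=0.$$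
   Context: Repeated indices are summed; Greek indices are raised/lowered with $g$. $e$ is the $2\times2$ identity matrix; $\mathrm{Herm}(2)$ = Hermitian $2\times2$ matrices; $\mathfrak{u}(2)$ = anti-Hermitian $2\times 2$ matrices; $\mathfrak{su}(2)$ = traceless elements of $\mathfrak{u}(2)$; $\dagger$ is the Hermitian conjugate. For $A\in\mathrm{Mat}(2,\mathbb{C})$: $\pi_+(A)=\tfrac12(\operatorname{tr}A)e$, $\pi_-(A)=A-\pi_+(A)$, $\tilde A=\pi_+(A)-\pi_-(A)$. Products of matrix-valued tensor fields are matrix products of components; the covariant derivative of a matrix-valued tensor field $V=v_a\sigma^a$ (Pauli basis $\sigma^0=e,\sigma^1,\sigma^2,\sigma^3$, complex tensor fields $v_a$) is $(\nabla v_a)\sigma^a$; on a matrix-valued function it is the ordinary derivative. *)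

theory Defs
  imports "HOL-Analysis.Analysis"
begin

text \<open>Local (coordinate chart) model: the manifold is represented by an open chart
  domain U in R^4 (coordinates indexed by the numeral type 4); tensor fields are given
  by their component functions in these coordinates.\<close>

type_synonym pt = "real^4"
type_synonym cmat = "complex^2^2"

text \<open>Partial derivative d_i f at x (coordinate direction i).\<close>
definition pd :: "4 \<Rightarrow> (pt \<Rightarrow> 'b::real_normed_vector) \<Rightarrow> pt \<Rightarrow> 'b" where
  "pd i f x = frechet_derivative f (at x) (axis i 1)"

text \<open>C^k on U: continuous for k = 0; differentiable with all partials C^(k-1).\<close>
fun Ck :: "nat \<Rightarrow> (pt \<Rightarrow> 'b::real_normed_vector) \<Rightarrow> pt set \<Rightarrow> bool" where
  "Ck 0 f U = continuous_on U f"
| "Ck (Suc k) f U = (f differentiable_on U \<and> (\<forall>i. Ck k (pd i f) U))"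

definition smooth_on :: "pt set \<Rightarrow> (pt \<Rightarrow> 'b::real_normed_vector) \<Rightarrow> bool" where
  "smooth_on U f = (\<forall>k. Ck k f U)"

text \<open>Lorentzian signature (either sign convention).\<close>
definition eta :: "real \<Rightarrow> real^4^4" where
  "eta s = (\<chi> i j. if i = j then (if i = 1 then s else - s) else 0)"

definition lorentzian :: "real^4^4 \<Rightarrow> bool" where
  "lorentzian G = (transpose G = G \<and>
     (\<exists>P::real^4^4. invertible P \<and> (transpose P ** G ** P = eta 1 \<or> transpose P ** G ** P = eta (-1))))"

text \<open>Inverse metric g^{mu nu} and Christoffel symbols Gamma^l_{m n}.\<close>
definition ginv :: "(pt \<Rightarrow> real^4^4) \<Rightarrow> pt \<Rightarrow> 4 \<Rightarrow> 4 \<Rightarrow> real" where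
  "ginv g x m n = matrix_inv (g x) $ m $ n"

definition christoffel :: "(pt \<Rightarrow> real^4^4) \<Rightarrow> pt \<Rightarrow> 4 \<Rightarrow> 4 \<Rightarrow> 4 \<Rightarrow> real" where
  "christoffel g x l m n = (1/2) * (\<Sum>r\<in>UNIV. ginv g x l r *
      (pd m g x $ r $ n + pd n g x $ r $ m - pd r g x $ m $ n))"

text \<open>Covariant divergence nabla_mu V^mu of a matrix-valued vector field V (components
  V x mu); the covariant derivative acts entrywise (i.e. on the coefficients v_a).\<close>
definition cdiv :: "(pt \<Rightarrow> real^4^4) \<Rightarrow> (pt \<Rightarrow> 4 \<Rightarrow> cmat) \<Rightarrow> pt \<Rightarrow> cmat" where
  "cdiv g V x = (\<Sum>m\<in>UNIV. pd m (\<lambda>y. V y m) x)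
       + (\<Sum>m\<in>UNIV. \<Sum>l\<in>UNIV. christoffel g x m m l *\<^sub>R V x l)"

text \<open>Matrix operations on Mat(2,C).\<close>
definition adj :: "cmat \<Rightarrow> cmat" where
  "adj A = (\<chi> i j. cnj (A $ j $ i))"

definition smul :: "complex \<Rightarrow> cmat \<Rightarrow> cmat" where
  "smul c A = (\<chi> i j. c * A $ i $ j)"

definition tr :: "cmat \<Rightarrow> complex" where
  "tr A = (\<Sum>i\<in>UNIV. A $ i $ i)"

definition pip :: "cmat \<Rightarrow> cmat" where
  "pip A = smul (tr A / 2) (mat 1)"

definition pim :: "cmat \<Rightarrow> cmat" where
  "pim A = A - pip A"

definition tld :: "cmat \<Rightarrow> cmat" where
  "tld A = pip A - pim A"

definition comm :: "cmat \<Rightarrow> cmat \<Rightarrow> cmat" where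
  "comm A B = A ** B - B ** A"

definition herm :: "cmat \<Rightarrow> bool" where "herm A = (adj A = A)"
definition in_u2 :: "cmat \<Rightarrow> bool" where "in_u2 A = (adj A = - A)"
definition in_su2 :: "cmat \<Rightarrow> bool" where "in_su2 A = (in_u2 A \<and> tr A = 0)"

end

theory Submission
  imports Defs
begin

(* Expanding the covariant divergence of the current \<Psi>\<^sup>\<dagger> iK\<^sup>\<mu> \<Psi> by the Leibniz rule produces
  the term \<Psi>\<^sup>\<dagger> i(\<nabla>\<^sub>\<mu>K\<^sup>\<mu>) \<Psi>. Since \<nabla>\<^sub>\<mu>\<pi>\<^sub>+(K\<^sup>\<mu>) = 0, the matrix \<nabla>\<^sub>\<mu>K\<^sup>\<mu> is traceless, so this term
  is exactly \<Psi>\<^sup>\<dagger> \<nabla>\<^sub>\<mu>\<pi>\<^sub>-(iK\<^sup>\<mu>) \<Psi> and cancels. The remaining derivatives of \<Psi> and \<Psi>\<^sup>\<dagger> are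
  eliminated by the Dirac equation and its adjoint (iK\<^sup>\<mu>, A\<^sub>\<mu>, C\<^sub>\<mu> are anti-Hermitian), after which
  the commutator terms cancel by pure matrix algebra; \<pi>\<^sub>+(iK\<^sup>\<mu>) is scalar, so
  [C\<^sub>\<mu>, \<pi>\<^sub>-(iK\<^sup>\<mu>)] = [C\<^sub>\<mu>, iK\<^sup>\<mu>]. *)

lemma bounded_bilinear_matrix_mult:
  "bounded_bilinear
    ((**) :: 'a::{real_normed_algebra_1,euclidean_space}^'n^'m \<Rightarrow> 'a^'p^'n \<Rightarrow> 'a^'p^'m)"
proof -
  have "bilinear ((**) :: 'a^'n^'m \<Rightarrow> 'a^'p^'n \<Rightarrow> 'a^'p^'m)"
    unfolding bilinear_def
    by (auto intro!: linearI simp: matrix_matrix_mult_def vec_eq_iff sum.distrib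
        scaleR_sum_right algebra_simps)
  then show ?thesis
    using bilinear_conv_bounded_bilinear by blast
qed

lemmas matrix_mult_sum_left = bounded_bilinear.sum_left[OF bounded_bilinear_matrix_mult]
lemmas matrix_mult_sum_right = bounded_bilinear.sum_right[OF bounded_bilinear_matrix_mult]
lemmas matrix_mult_add_left = bounded_bilinear.add_left[OF bounded_bilinear_matrix_mult]
lemmas matrix_mult_add_right = bounded_bilinear.add_right[OF bounded_bilinear_matrix_mult]
lemmas matrix_mult_diff_left = bounded_bilinear.diff_left[OF bounded_bilinear_matrix_mult]
lemmas matrix_mult_diff_right = bounded_bilinear.diff_right[OF bounded_bilinear_matrix_mult]
lemmas matrix_mult_minus_left = bounded_bilinear.minus_left[OF bounded_bilinear_matrix_mult]
lemmas matrix_mult_minus_right = bounded_bilinear.minus_right[OF bounded_bilinear_matrix_mult]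
lemmas matrix_mult_scaleR_left = bounded_bilinear.scaleR_left[OF bounded_bilinear_matrix_mult]
lemmas matrix_mult_scaleR_right = bounded_bilinear.scaleR_right[OF bounded_bilinear_matrix_mult]

lemma pd_eq_derivative:
  assumes "(f has_derivative f') (at x)"
  shows "pd i f x = f' (axis i 1)"
  unfolding pd_def frechet_derivative_at[OF assms, symmetric] ..

lemma pd_bounded_linear:
  assumes "bounded_linear L" and "f differentiable at x"
  shows "pd i (\<lambda>y. L (f y)) x = L (pd i f x)"
proof -
  have "(f has_derivative frechet_derivative f (at x)) (at x)"
    using assms(2) frechet_derivative_works by blast
  then have "((\<lambda>y. L (f y)) has_derivative (\<lambda>h. L (frechet_derivative f (at x) h))) (at x)"
    by (rule bounded_linear.has_derivative[OF assms(1)])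
  from pd_eq_derivative[OF this] show ?thesis
    unfolding pd_def .
qed

lemma differentiable_bounded_linear:
  assumes "bounded_linear L" and "f differentiable at x"
  shows "(\<lambda>y. L (f y)) differentiable at x"
  using differentiable_chain_at[OF assms(2) bounded_linear_imp_differentiable[OF assms(1)]]
  by (simp add: o_def)

lemma has_derivative_matrix_mult:
  fixes f :: "pt \<Rightarrow> 'a::{real_normed_algebra_1,euclidean_space}^'n^'m"
    and g :: "pt \<Rightarrow> 'a^'p^'n"
  assumes "f differentiable at x" and "g differentiable at x"
  shows "((\<lambda>y. f y ** g y) has_derivative
           (\<lambda>h. f x ** frechet_derivative g (at x) h + frechet_derivative f (at x) h ** g x)) (at x)"
proof -
  have "(f has_derivative frechet_derivative f (at x)) (at x)"
    and "(g has_derivative frechet_derivative g (at x)) (at x)"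
    using assms frechet_derivative_works by blast+
  then show ?thesis
    by (rule bounded_bilinear.FDERIV[OF bounded_bilinear_matrix_mult])
qed

lemma differentiable_matrix_mult:
  fixes f :: "pt \<Rightarrow> 'a::{real_normed_algebra_1,euclidean_space}^'n^'m"
    and g :: "pt \<Rightarrow> 'a^'p^'n"
  assumes "f differentiable at x" and "g differentiable at x"
  shows "(\<lambda>y. f y ** g y) differentiable at x"
  using has_derivative_matrix_mult[OF assms] by (rule differentiableI)

lemma pd_matrix_mult:
  fixes f :: "pt \<Rightarrow> 'a::{real_normed_algebra_1,euclidean_space}^'n^'m"
    and g :: "pt \<Rightarrow> 'a^'p^'n"
  assumes "f differentiable at x" and "g differentiable at x"
  shows "pd i (\<lambda>y. f y ** g y) x = pd i f x ** g x + f x ** pd i g x"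
  using pd_eq_derivative[OF has_derivative_matrix_mult[OF assms]]
  by (simp add: pd_def add.commute)

lemma smooth_on_imp_differentiable:
  assumes "smooth_on U f" and "open U" and "x \<in> U"
  shows "f differentiable at x"
proof -
  have "Ck (Suc 0) f U"
    using assms(1) unfolding smooth_on_def by blast
  then show ?thesis
    using assms(2,3) differentiable_on_eq_differentiable_at by auto
qed

lemma cdiv_bounded_linear:
  assumes "bounded_linear L" and "\<And>m. (\<lambda>y. V y m) differentiable at x"
  shows "cdiv g (\<lambda>y m. L (V y m)) x = L (cdiv g V x)"
proof -
  have lin: "linear L"
    using assms(1) by (rule bounded_linear.linear)
  show ?thesis
    unfolding cdiv_def pd_bounded_linear[OF assms]
    by (simp add: linear_add[OF lin] linear_sum[OF lin] linear_scale[OF lin])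
qed

lemma cdiv_matrix_mult_sandwich:
  fixes F G :: "pt \<Rightarrow> cmat"
  assumes F: "F differentiable at x" and G: "G differentiable at x"
    and V: "\<And>m. (\<lambda>y. V y m) differentiable at x"
  shows "cdiv g (\<lambda>y m. F y ** V y m ** G y) x
    = (\<Sum>m\<in>UNIV. pd m F x ** V x m ** G x + F x ** V x m ** pd m G x) + F x ** cdiv g V x ** G x"
proof -
  have pd_FVG: "pd m (\<lambda>y. F y ** V y m ** G y) x
      = pd m F x ** V x m ** G x + F x ** V x m ** pd m G x + F x ** pd m (\<lambda>y. V y m) x ** G x"
    for m
    using pd_matrix_mult[OF differentiable_matrix_mult[OF F V] G]
      pd_matrix_mult[OF F V] by (simp add: matrix_mult_add_left)
  show ?thesis
    unfolding cdiv_def pd_FVG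
    by (simp add: sum.distrib matrix_mult_add_left matrix_mult_add_right matrix_mult_sum_left
        matrix_mult_sum_right matrix_mult_scaleR_left matrix_mult_scaleR_right)
qed

lemma bounded_linear_adj: "bounded_linear adj"
  by (rule bounded_linearI') (auto simp: adj_def vec_eq_iff)

lemma bounded_linear_smul: "bounded_linear (smul c)"
  by (rule bounded_linearI') (auto simp: smul_def vec_eq_iff algebra_simps)

lemma tr_add: "tr (A + B) = tr A + tr B"
  by (simp add: tr_def sum.distrib)

lemma tr_scaleR: "tr (r *\<^sub>R A) = r *\<^sub>R tr A"
  by (simp add: tr_def scaleR_sum_right)

lemma tr_smul: "tr (smul c A) = c * tr A"
  by (simp add: tr_def smul_def sum_distrib_left)

lemma bounded_linear_pip: "bounded_linear pip"
  by (rule bounded_linearI')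
    (auto simp: pip_def smul_def tr_add tr_scaleR vec_eq_iff algebra_simps add_divide_distrib)

lemma bounded_linear_pim: "bounded_linear pim"
  unfolding pim_def by (intro bounded_linear_sub bounded_linear_ident bounded_linear_pip)

lemma adj_matrix_mult: "adj (A ** B) = adj B ** adj A"
  by (simp add: adj_def vec_eq_iff matrix_matrix_mult_def mult.commute)

lemma adj_smul: "adj (smul c A) = smul (cnj c) (adj A)"
  by (simp add: adj_def vec_eq_iff smul_def)

lemma smul_matrix_mult_left: "smul c A ** B = smul c (A ** B)"
  by (simp add: vec_eq_iff smul_def matrix_matrix_mult_def sum_distrib_left mult.assoc)

lemma smul_matrix_mult_right: "A ** smul c B = smul c (A ** B)"
  by (simp add: vec_eq_iff smul_def matrix_matrix_mult_def sum_distrib_left algebra_simps)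

lemma pip_smul: "pip (smul c A) = smul c (pip A)"
  unfolding pip_def tr_smul by (simp add: vec_eq_iff smul_def mat_def)

lemma pim_smul_eq_self:
  assumes "pip A = 0"
  shows "pim (smul c A) = smul c A"
  unfolding pim_def pip_smul assms
  using linear_0[OF bounded_linear.linear[OF bounded_linear_smul]] by simp

lemma comm_pim: "comm C (pim A) = comm C A"
  unfolding comm_def pim_def pip_def
  by (simp add: matrix_mult_diff_left matrix_mult_diff_right smul_matrix_mult_left
      smul_matrix_mult_right)

lemma herm_imp_in_u2_smul_ii:
  assumes "herm A"
  shows "in_u2 (smul \<i> A)"
  using assms unfolding herm_def in_u2_def adj_smul
  by (simp add: vec_eq_iff smul_def)

lemma dirac_adjoint:
  fixes N A C D :: "'i::finite \<Rightarrow> cmat"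
  assumes N: "\<And>m. in_u2 (N m)" and A: "\<And>m. in_u2 (A m)" and C: "\<And>m. in_u2 (C m)"
    and dirac: "(\<Sum>m\<in>UNIV. N m ** (D m - C m ** P + P ** A m)) = 0"
  shows "(\<Sum>m\<in>UNIV. adj (D m) ** N m) = (\<Sum>m\<in>UNIV. (A m ** adj P - adj P ** C m) ** N m)"
proof -
  have lin: "linear adj"
    by (rule bounded_linear.linear[OF bounded_linear_adj])
  have "adj (N m ** (D m - C m ** P + P ** A m))
      = (A m ** adj P - adj P ** C m) ** N m - adj (D m) ** N m" for m
    using N A C unfolding in_u2_def adj_matrix_mult linear_add[OF lin] linear_diff[OF lin]
    by (simp add: matrix_mult_minus_left matrix_mult_minus_right matrix_mult_diff_left
        matrix_mult_add_left algebra_simps)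
  then have "(\<Sum>m\<in>UNIV. (A m ** adj P - adj P ** C m) ** N m - adj (D m) ** N m) = 0"
    using arg_cong[OF dirac, of adj] by (simp add: linear_sum[OF lin] linear_0[OF lin])
  then show ?thesis
    by (simp add: sum_subtractf)
qed

lemma dirac_current_identity:
  fixes N A C D :: "'i::finite \<Rightarrow> cmat"
  assumes N: "\<And>m. in_u2 (N m)" and A: "\<And>m. in_u2 (A m)" and C: "\<And>m. in_u2 (C m)"
    and dirac: "(\<Sum>m\<in>UNIV. N m ** (D m - C m ** P + P ** A m)) = 0"
  shows "(\<Sum>m\<in>UNIV. adj (D m) ** N m ** P + adj P ** N m ** D m)
    - (\<Sum>m\<in>UNIV. comm (A m) (adj P ** N m ** P)) + adj P ** (\<Sum>m\<in>UNIV. comm (C m) (N m)) ** P = 0"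
proof -
  let ?Q = "adj P"
  have "(\<Sum>m\<in>UNIV. adj (D m) ** N m ** P) = (\<Sum>m\<in>UNIV. adj (D m) ** N m) ** P"
    by (simp add: matrix_mult_sum_left)
  also have "\<dots> = (\<Sum>m\<in>UNIV. (A m ** ?Q - ?Q ** C m) ** N m ** P)"
    by (simp add: dirac_adjoint[OF N A C dirac] matrix_mult_sum_left)
  finally have adjoint: "(\<Sum>m\<in>UNIV. adj (D m) ** N m ** P)
      = (\<Sum>m\<in>UNIV. (A m ** ?Q - ?Q ** C m) ** N m ** P)" .
  have "(\<Sum>m\<in>UNIV. N m ** D m) = (\<Sum>m\<in>UNIV. N m ** (C m ** P - P ** A m))"
    using dirac by (simp add: matrix_mult_diff_right matrix_mult_add_right sum_subtractf
        sum.distrib algebra_simps)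
  then have "?Q ** (\<Sum>m\<in>UNIV. N m ** D m) = ?Q ** (\<Sum>m\<in>UNIV. N m ** (C m ** P - P ** A m))"
    by simp
  then have direct: "(\<Sum>m\<in>UNIV. ?Q ** N m ** D m)
      = (\<Sum>m\<in>UNIV. ?Q ** N m ** (C m ** P - P ** A m))"
    by (simp add: matrix_mult_sum_right matrix_mul_assoc)
  have "(A m ** ?Q - ?Q ** C m) ** N m ** P + ?Q ** N m ** (C m ** P - P ** A m)
      - comm (A m) (?Q ** N m ** P) + ?Q ** comm (C m) (N m) ** P = 0" for m
    by (simp add: vec_eq_iff matrix_matrix_mult_def sum_2 comm_def algebra_simps)
  then have "(\<Sum>m\<in>UNIV. (A m ** ?Q - ?Q ** C m) ** N m ** P + ?Q ** N m ** (C m ** P - P ** A m)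
      - comm (A m) (?Q ** N m ** P) + ?Q ** comm (C m) (N m) ** P) = 0"
    by simp
  then show ?thesis
    by (simp add: sum.distrib sum_subtractf adjoint direct matrix_mult_sum_left
        matrix_mult_sum_right)
qed

lemma matrix_mult_sandwich_cancel:
  fixes S X Y Z Q P :: cmat
  shows "(S + Q ** Z ** P - X) - Q ** (Z - Y) ** P = S - X + Q ** Y ** P"
  by (simp add: matrix_mult_diff_left matrix_mult_diff_right)

lemma dirac_current_conservation_at:
  fixes K A C :: "pt \<Rightarrow> 4 \<Rightarrow> cmat" and \<Psi> :: "pt \<Rightarrow> cmat"
  assumes d\<Psi>: "\<Psi> differentiable at x" and dK: "\<And>m. (\<lambda>y. K y m) differentiable at x"
    and K_herm: "\<And>m. herm (K x m)" and A_u2: "\<And>m. in_u2 (A x m)" and C_u2: "\<And>m. in_u2 (C x m)"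
    and K_div: "cdiv g (\<lambda>y m. pip (K y m)) x = 0"
    and Dirac: "(\<Sum>m\<in>UNIV. smul \<i> (K x m) ** (pd m \<Psi> x - C x m ** \<Psi> x + \<Psi> x ** A x m)) = 0"
  shows "(cdiv g (\<lambda>y m. adj (\<Psi> y) ** smul \<i> (K y m) ** \<Psi> y) x
       - (\<Sum>m\<in>UNIV. comm (A x m) (adj (\<Psi> x) ** smul \<i> (K x m) ** \<Psi> x)))
    - adj (\<Psi> x) ** (cdiv g (\<lambda>y m. pim (smul \<i> (K y m))) x
       - (\<Sum>m\<in>UNIV. comm (C x m) (pim (smul \<i> (K x m))))) ** \<Psi> x = 0"
proof -
  have div_current: "cdiv g (\<lambda>y m. adj (\<Psi> y) ** smul \<i> (K y m) ** \<Psi> y) x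
      = (\<Sum>m\<in>UNIV. adj (pd m \<Psi> x) ** smul \<i> (K x m) ** \<Psi> x
                    + adj (\<Psi> x) ** smul \<i> (K x m) ** pd m \<Psi> x)
        + adj (\<Psi> x) ** smul \<i> (cdiv g K x) ** \<Psi> x"
    using cdiv_matrix_mult_sandwich[OF differentiable_bounded_linear[OF bounded_linear_adj d\<Psi>] d\<Psi>
        differentiable_bounded_linear[OF bounded_linear_smul dK]]
    by (simp add: pd_bounded_linear[OF bounded_linear_adj d\<Psi>]
        cdiv_bounded_linear[where V=K, OF bounded_linear_smul dK])
  have "pip (cdiv g K x) = 0"
    using cdiv_bounded_linear[where V=K, OF bounded_linear_pip dK] K_div by simp
  then have div_pim: "cdiv g (\<lambda>y m. pim (smul \<i> (K y m))) x = smul \<i> (cdiv g K x)"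
    using cdiv_bounded_linear[where V=K, OF bounded_linear_compose[OF bounded_linear_pim bounded_linear_smul] dK]
    by (simp add: pim_smul_eq_self)
  show ?thesis
    unfolding div_current div_pim comm_pim matrix_mult_sandwich_cancel
    by (rule dirac_current_identity[OF herm_imp_in_u2_smul_ii[OF K_herm] A_u2 C_u2 Dirac])
qed

theorem theorem3:
  fixes U :: "pt set" and g :: "pt \<Rightarrow> real^4^4"
    and K A C :: "pt \<Rightarrow> 4 \<Rightarrow> cmat" and \<Psi> :: "pt \<Rightarrow> cmat"
  assumes U: "open U"
    and g_smooth: "smooth_on U g"
    and g_lor: "\<forall>x\<in>U. lorentzian (g x)"
    and K_smooth: "\<forall>m. smooth_on U (\<lambda>x. K x m)"
    and K_herm: "\<forall>x\<in>U. \<forall>m. herm (K x m)"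
    and K_cliff: "\<forall>x\<in>U. \<forall>m n. K x m ** tld (K x n) + K x n ** tld (K x m)
                      = (2 * ginv g x m n) *\<^sub>R mat 1"
    and K_div: "\<forall>x\<in>U. cdiv g (\<lambda>y m. pip (K y m)) x = 0"
    and A_smooth: "\<forall>m. smooth_on U (\<lambda>x. A x m)"
    and A_u2: "\<forall>x\<in>U. \<forall>m. in_u2 (A x m)"
    and C_smooth: "\<forall>m. smooth_on U (\<lambda>x. C x m)"
    and C_su2: "\<forall>x\<in>U. \<forall>m. in_su2 (C x m)"
    and Psi_smooth: "smooth_on U \<Psi>"
    and Dirac: "\<forall>x\<in>U. (\<Sum>m\<in>UNIV. smul \<i> (K x m) **
                 (pd m \<Psi> x - C x m ** \<Psi> x + \<Psi> x ** A x m)) = 0"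
  shows "\<forall>x\<in>U.
    (cdiv g (\<lambda>y m. adj (\<Psi> y) ** smul \<i> (K y m) ** \<Psi> y) x
       - (\<Sum>m\<in>UNIV. comm (A x m) (adj (\<Psi> x) ** smul \<i> (K x m) ** \<Psi> x)))
    - adj (\<Psi> x) ** (cdiv g (\<lambda>y m. pim (smul \<i> (K y m))) x
       - (\<Sum>m\<in>UNIV. comm (C x m) (pim (smul \<i> (K x m))))) ** \<Psi> x = 0"
proof -
  have "\<Psi> differentiable at x" if "x \<in> U" for x
    using smooth_on_imp_differentiable[OF Psi_smooth U that] .
  moreover have "(\<lambda>y. K y m) differentiable at x" if "x \<in> U" for x m
    using smooth_on_imp_differentiable[OF _ U that] K_smooth by blast
  ultimately show ?thesis
    using K_herm A_u2 C_su2 K_div Dirac unfolding in_su2_def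
    by - (intro ballI dirac_current_conservation_at; auto)
qed

end
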